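(* Let $G$ be a finite nontrivial group and let $d_{\min}$ denote the smallest dimension of a nontrivial irreducible complex representation of $G$. Let $d_\psi \ge 1$ be an integer and let $\psi : G \to \mathsf{U}_{d_\psi}$ be any function. If $x, y \in G$ are independent and uniformly random, then $$\Pr[\psi(xy) = \psi(x)\,\psi(y)] \;\le\; \frac12 \left( 1 + \left\| \mathbb{E}_x \psi(x) \right\|_{\mathrm{op}}^3 + \sqrt{\frac{d_\psi}{d_{\min}}} \right).$$
   Context: $\mathsf{U}_d$ is the group of $d\times d$ complex unitary matrices. The function $\psi$ is arbitrary; it is not assumed to be a homomorphism. $\mathbb{E}_x$ denotes the average over uniformly random $x\in G$. $\|A\|_{\mathrm{op}}$ is the operator norm with respect to the Euclidean norm on $\mathbb{C}^d$. The trivial representation is the one-dimensional representation sending every group element to $1$. *)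

theory Defs
  imports
    "HOL-Algebra.Group"
    "Jordan_Normal_Form.VS_Connect"
    "HOL-Probability.Probability"
begin

text \<open>
  Representations need their dimension to range over the natural numbers, so they use the
  matrices of Jordan_Normal_Form, whose dimension is a value. The function \<open>\<psi>\<close> takes values in
  matrices of one fixed dimension and uses the type \<open>complex ^ 'n ^ 'n\<close> of dimension
  \<open>CARD('n) \<ge> 1\<close>, on which the norm, the operator norm \<open>onorm\<close> and expectations of HOL-Analysis
  and HOL-Probability are available.
\<close>

no_notation Matrix.vec_index (infixl "$" 100)

definition GL :: "nat \<Rightarrow> complex mat monoid" where
  "GL d = units_of (ring_mat TYPE(complex) d ())"

definition representation :: "('a, 'b) monoid_scheme \<Rightarrow> nat \<Rightarrow> ('a \<Rightarrow> complex mat) \<Rightarrow> bool" where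
  "representation G d \<rho> \<longleftrightarrow> \<rho> \<in> hom G (GL d)"

definition invariant_subspace ::
  "('a, 'b) monoid_scheme \<Rightarrow> nat \<Rightarrow> ('a \<Rightarrow> complex mat) \<Rightarrow> complex Matrix.vec set \<Rightarrow> bool" where
  "invariant_subspace G d \<rho> W \<longleftrightarrow>
     VectorSpace.subspace class_ring W (module_vec TYPE(complex) d) \<and>
     (\<forall>g\<in>carrier G. \<forall>w\<in>W. \<rho> g *\<^sub>v w \<in> W)"

definition irreducible_representation ::
  "('a, 'b) monoid_scheme \<Rightarrow> nat \<Rightarrow> ('a \<Rightarrow> complex mat) \<Rightarrow> bool" where
  "irreducible_representation G d \<rho> \<longleftrightarrow>
     representation G d \<rho> \<and> d > 0 \<and>
     (\<forall>W. invariant_subspace G d \<rho> W \<longrightarrow> W = {0\<^sub>v d} \<or> W = carrier_vec d)"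

text \<open>
  A representation isomorphic to the trivial one is equal to it, because conjugation fixes the
  identity matrix; so no quotient by isomorphism is needed here.
\<close>
definition trivial_representation ::
  "('a, 'b) monoid_scheme \<Rightarrow> nat \<Rightarrow> ('a \<Rightarrow> complex mat) \<Rightarrow> bool" where
  "trivial_representation G d \<rho> \<longleftrightarrow> d = 1 \<and> (\<forall>g\<in>carrier G. \<rho> g = 1\<^sub>m 1)"

text \<open>
  A nontrivial finite group has a nontrivial irreducible representation, so for such groups the
  minimum is attained.
\<close>
definition d_min :: "('a, 'b) monoid_scheme \<Rightarrow> nat" where
  "d_min G = (LEAST d. \<exists>\<rho>. irreducible_representation G d \<rho> \<and> \<not> trivial_representation G d \<rho>)"

definition conjugate_transpose :: "complex ^ 'n ^ 'm \<Rightarrow> complex ^ 'm ^ 'n" where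
  "conjugate_transpose A = (\<chi> i j. cnj (A $ j $ i))"

definition unitary_matrices :: "(complex ^ 'n ^ 'n) set" where
  "unitary_matrices =
     {U. U ** conjugate_transpose U = Finite_Cartesian_Product.mat 1 \<and>
         conjugate_transpose U ** U = Finite_Cartesian_Product.mat 1}"

end

theory Submission
  imports Defs
begin

text \<open>
  For unitary \<open>U\<close>, \<open>V\<close> of size \<open>d\<close>, \<open>Re tr (U\<^sup>* V) \<ge> d (2 [U = V] - 1)\<close>, so it suffices to bound the average
  of \<open>Re tr (\<psi>(xy)\<^sup>* \<psi>(x) \<psi>(y))\<close>. Write \<open>\<psi> = M + F\<close> where \<open>M\<close> is the average of \<open>\<psi>\<close>; all mixed terms average to
  zero. The constant part is \<open>Re tr (M\<^sup>* M M) \<le> d |M|\<^sup>3\<close>. The part in \<open>F\<close> is a sum of terms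
  \<open>\<langle>F\<^sub>i\<^sub>j, F\<^sub>i\<^sub>k * F\<^sub>k\<^sub>j\<rangle>\<close>, and convolution with a function \<open>f\<close> has norm at most \<open>|f| / sqrt d\<^sub>m\<^sub>i\<^sub>n\<close> on mean zero
  functions: its top singular space is translation invariant, hence of dimension at least \<open>d\<^sub>m\<^sub>i\<^sub>n\<close>,
  and the squared singular values sum to \<open>|f|\<^sup>2\<close>.
\<close>

no_notation Matrix.scalar_prod (infix "\<bullet>" 70)

section \<open>Orthonormal families of functions on a finite set\<close>

definition fun_inner :: "'a set \<Rightarrow> ('a \<Rightarrow> complex) \<Rightarrow> ('a \<Rightarrow> complex) \<Rightarrow> complex" where
  "fun_inner S f g = (\<Sum>x\<in>S. f x * cnj (g x))"

definition norm_sq :: "'a set \<Rightarrow> ('a \<Rightarrow> complex) \<Rightarrow> real" where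
  "norm_sq S f = (\<Sum>x\<in>S. (cmod (f x))\<^sup>2)"

lemma fun_inner_self: "fun_inner S f f = of_real (norm_sq S f)"
  by (simp add: fun_inner_def norm_sq_def complex_norm_square del: of_real_power)

lemma fun_inner_commute: "fun_inner S f g = cnj (fun_inner S g f)"
  by (simp add: fun_inner_def mult.commute)

lemma fun_inner_diff_left:
  "fun_inner S (\<lambda>x. f x - g x) h = fun_inner S f h - fun_inner S g h"
  by (simp add: fun_inner_def sum_subtractf algebra_simps)

lemma fun_inner_diff_right:
  "fun_inner S h (\<lambda>x. f x - g x) = fun_inner S h f - fun_inner S h g"
  by (simp add: fun_inner_def sum_subtractf algebra_simps)

lemma fun_inner_scale_left: "fun_inner S (\<lambda>x. c * f x) h = c * fun_inner S f h"
  by (simp add: fun_inner_def sum_distrib_left algebra_simps)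

lemma fun_inner_scale_right: "fun_inner S h (\<lambda>x. c * f x) = cnj c * fun_inner S h f"
  by (simp add: fun_inner_def sum_distrib_left algebra_simps)

lemma fun_inner_sum_left:
  "fun_inner S (\<lambda>x. \<Sum>i\<in>I. c i * w i x) h = (\<Sum>i\<in>I. c i * fun_inner S (w i) h)"
  unfolding fun_inner_def sum_distrib_right sum_distrib_left
  by (subst sum.swap) (simp add: mult.assoc)

lemma fun_inner_sum_right:
  "fun_inner S h (\<lambda>x. \<Sum>i\<in>I. c i * w i x) = (\<Sum>i\<in>I. cnj (c i) * fun_inner S h (w i))"
  by (subst fun_inner_commute) (simp add: fun_inner_sum_left fun_inner_commute [of S h])

lemma norm_sq_nonneg: "0 \<le> norm_sq S f"
  by (simp add: norm_sq_def sum_nonneg)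

lemma norm_sq_eq_0_iff: "finite S \<Longrightarrow> norm_sq S f = 0 \<longleftrightarrow> (\<forall>x\<in>S. f x = 0)"
  by (simp add: norm_sq_def sum_nonneg_eq_0_iff)

lemma norm_sq_scale: "norm_sq S (\<lambda>x. c * f x) = (cmod c)\<^sup>2 * norm_sq S f"
  by (simp add: norm_sq_def norm_mult power_mult_distrib sum_distrib_left)

lemma norm_sq_parallelogram:
  "norm_sq S (\<lambda>x. f x + g x) + norm_sq S (\<lambda>x. f x - g x) = 2 * norm_sq S f + 2 * norm_sq S g"
proof -
  have "(cmod (a + b))\<^sup>2 + (cmod (a - b))\<^sup>2 = 2 * (cmod a)\<^sup>2 + 2 * (cmod b)\<^sup>2" for a b
    unfolding cmod_power2 by (simp add: power2_eq_square algebra_simps)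
  then show ?thesis
    unfolding norm_sq_def sum_distrib_left sum.distrib [symmetric] by simp
qed

definition orthonormal_family :: "'a set \<Rightarrow> nat \<Rightarrow> (nat \<Rightarrow> 'a \<Rightarrow> complex) \<Rightarrow> bool" where
  "orthonormal_family S k w \<longleftrightarrow>
     (\<forall>i<k. \<forall>j<k. fun_inner S (w i) (w j) = (if i = j then 1 else 0))"

lemma orthonormal_coefficient:
  assumes "orthonormal_family S k w" "j < k"
  shows "fun_inner S (\<lambda>x. \<Sum>i<k. c i * w i x) (w j) = c j"
proof -
  have "(\<Sum>i<k. c i * fun_inner S (w i) (w j)) = (\<Sum>i<k. if i = j then c i else 0)"
    using assms by (intro sum.cong) (auto simp: orthonormal_family_def)
  then show ?thesis
    using assms by (simp add: fun_inner_sum_left)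
qed

text \<open>Pythagoras: the residual is orthogonal to each \<open>w j\<close>, hence to the
  projection \<open>p\<close>, so the squared norm of \<open>f\<close> splits into that of
  \<open>r\<close> and the sum of the squared coefficients.\<close>

lemma norm_sq_orthogonal_residual:
  fixes f :: "'a \<Rightarrow> complex"
  assumes w: "orthonormal_family S k w"
  defines "r \<equiv> \<lambda>x. f x - (\<Sum>i<k. fun_inner S f (w i) * w i x)"
  shows "norm_sq S r = norm_sq S f - (\<Sum>i<k. (cmod (fun_inner S f (w i)))\<^sup>2)"
    and "j < k \<Longrightarrow> fun_inner S r (w j) = 0"
proof -
  define p where "p = (\<lambda>x. \<Sum>i<k. fun_inner S f (w i) * w i x)"
  have r: "r = (\<lambda>x. f x - p x)"
    by (simp add: r_def p_def)
  show orth: "fun_inner S r (w j) = 0" if "j < k" for j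
    using orthonormal_coefficient [OF w that, of "\<lambda>i. fun_inner S f (w i)"]
    by (simp add: r p_def fun_inner_diff_left)
  have "fun_inner S r p = 0"
    by (simp add: p_def fun_inner_sum_right orth)
  \<comment> \<open>Only the second \<open>r\<close> is unfolded into \<open>f - p\<close>;
    orthogonality to \<open>p\<close> removes the other term.\<close>
  then have "fun_inner S r r = fun_inner S r f"
    by (subst (2) r) (simp add: fun_inner_diff_right)
  also have "\<dots> = fun_inner S f f - fun_inner S p f"
    by (simp add: r fun_inner_diff_left)
  also have "fun_inner S p f = (\<Sum>i<k. of_real ((cmod (fun_inner S f (w i)))\<^sup>2))"
    unfolding p_def fun_inner_sum_left
    by (subst fun_inner_commute [of S _ f]) (simp only: complex_norm_square complex_cnj_cnj mult.commute)
  finally have "complex_of_real (norm_sq S r)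
      = of_real (norm_sq S f - (\<Sum>i<k. (cmod (fun_inner S f (w i)))\<^sup>2))"
    by (simp add: fun_inner_self)
  then show "norm_sq S r = norm_sq S f - (\<Sum>i<k. (cmod (fun_inner S f (w i)))\<^sup>2)"
    by (simp only: of_real_eq_iff)
qed

lemma bessel_inequality:
  assumes "orthonormal_family S k w"
  shows "(\<Sum>i<k. (cmod (fun_inner S f (w i)))\<^sup>2) \<le> norm_sq S f"
  using norm_sq_orthogonal_residual(1) [OF assms, of f]
    norm_sq_nonneg [of S "\<lambda>x. f x - (\<Sum>i<k. fun_inner S f (w i) * w i x)"]
  by linarith

text \<open>The right side is the squared Hilbert-Schmidt norm of the operator with kernel
  \<open>K\<close>. For fixed \<open>y\<close> the values at \<open>y\<close> of the images of the
  \<open>w i\<close> are, up to conjugation, the coefficients of the conjugated row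
  \<open>K y\<close>, so Bessel applies row by row.\<close>

lemma sum_norm_sq_kernel_le:
  assumes "orthonormal_family S k w"
  shows "(\<Sum>i<k. norm_sq S (\<lambda>y. \<Sum>z\<in>S. K y z * w i z)) \<le> (\<Sum>y\<in>S. \<Sum>z\<in>S. (cmod (K y z))\<^sup>2)"
proof -
  have "(\<Sum>i<k. norm_sq S (\<lambda>y. \<Sum>z\<in>S. K y z * w i z))
      = (\<Sum>y\<in>S. \<Sum>i<k. (cmod (\<Sum>z\<in>S. K y z * w i z))\<^sup>2)"
    unfolding norm_sq_def by (rule sum.swap)
  also have "\<dots> = (\<Sum>y\<in>S. \<Sum>i<k. (cmod (fun_inner S (\<lambda>z. cnj (K y z)) (w i)))\<^sup>2)"
  proof -
    have "cmod (\<Sum>z\<in>S. K y z * w i z) = cmod (fun_inner S (\<lambda>z. cnj (K y z)) (w i))" for y i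
      by (subst complex_mod_cnj [symmetric]) (simp add: fun_inner_def del: complex_mod_cnj)
    then show ?thesis by simp
  qed
  also have "\<dots> \<le> (\<Sum>y\<in>S. norm_sq S (\<lambda>z. cnj (K y z)))"
    by (intro sum_mono bessel_inequality assms)
  finally show ?thesis
    by (simp add: norm_sq_def)
qed

text \<open>The kernel bound for the identity kernel: the left side becomes \<open>k\<close> and the
  right side \<open>card S\<close>.\<close>

lemma orthonormal_family_card_le:
  assumes "orthonormal_family S k w" "finite S"
  shows "k \<le> card S"
proof -
  have "norm_sq S (w i) = 1" if "i < k" for i
  proof -
    have "complex_of_real (norm_sq S (w i)) = 1"
      using assms that by (simp add: orthonormal_family_def flip: fun_inner_self)
    then show ?thesis by simp
  qed
  moreover have "norm_sq S (\<lambda>y. \<Sum>z\<in>S. (if y = z then 1 else 0) * w i z) = norm_sq S (w i)" for i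
    using assms(2) unfolding norm_sq_def by (intro sum.cong) (simp_all add: if_distrib [of "\<lambda>c. c * _"] cong: if_cong)
  moreover have "(\<Sum>y\<in>S. \<Sum>z\<in>S. (cmod (if y = z then 1 else 0))\<^sup>2) = real (card S)"
    using assms(2) by (simp add: if_distrib [of cmod] if_distrib [of "\<lambda>c. c\<^sup>2"] cong: if_cong)
  ultimately have "real k \<le> real (card S)"
    using sum_norm_sq_kernel_le [OF assms(1), of "\<lambda>y z. if y = z then 1 else 0"] by simp
  then show ?thesis by simp
qed

section \<open>Subspaces of functions supported on a finite set, and their dimension\<close>

definition fun_subspace :: "'a set \<Rightarrow> ('a \<Rightarrow> complex) set \<Rightarrow> bool" where
  "fun_subspace S W \<longleftrightarrow>
     (\<lambda>_. 0) \<in> W \<and>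
     (\<forall>f\<in>W. \<forall>g\<in>W. (\<lambda>x. f x + g x) \<in> W) \<and>
     (\<forall>c. \<forall>f\<in>W. (\<lambda>x. c * f x) \<in> W) \<and>
     (\<forall>f\<in>W. \<forall>x. x \<notin> S \<longrightarrow> f x = 0)"

lemma fun_subspaceD:
  assumes "fun_subspace S W"
  shows fun_subspace_zero: "(\<lambda>_. 0) \<in> W"
    and fun_subspace_add: "f \<in> W \<Longrightarrow> g \<in> W \<Longrightarrow> (\<lambda>x. f x + g x) \<in> W"
    and fun_subspace_scale: "f \<in> W \<Longrightarrow> (\<lambda>x. c * f x) \<in> W"
    and fun_subspace_support: "f \<in> W \<Longrightarrow> x \<notin> S \<Longrightarrow> f x = 0"
  using assms unfolding fun_subspace_def by simp_all

lemma fun_subspace_sum: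
  assumes "fun_subspace S W" "\<And>i. i < k \<Longrightarrow> w i \<in> W"
  shows "(\<lambda>x. \<Sum>i<k::nat. c i * w i x) \<in> W"
  using assms(2)
proof (induction k)
  case 0
  then show ?case using assms(1) by (simp add: fun_subspace_def)
next
  case (Suc k)
  then have "(\<lambda>x. \<Sum>i<k. c i * w i x) \<in> W" "(\<lambda>x. c k * w k x) \<in> W"
    using assms(1) by (simp_all add: fun_subspace_def)
  then have "(\<lambda>x. (\<Sum>i<k. c i * w i x) + c k * w k x) \<in> W"
    by (rule fun_subspace_add [OF assms(1)])
  then show ?case by simp
qed

lemma fun_subspace_diff:
  assumes "fun_subspace S W" "f \<in> W" "g \<in> W"
  shows "(\<lambda>x. f x - g x) \<in> W"
  using fun_subspace_add [OF assms(1,2) fun_subspace_scale [OF assms(1,3), of "-1"]] by simp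

text \<open>Dimension is measured by orthonormal families, so that no linear independence is needed.\<close>
definition fun_dim :: "'a set \<Rightarrow> ('a \<Rightarrow> complex) set \<Rightarrow> nat" where
  "fun_dim S W = (GREATEST k. \<exists>w. orthonormal_family S k w \<and> (\<forall>i<k. w i \<in> W))"

lemma orthonormal_family_le_fun_dim:
  assumes "finite S" "orthonormal_family S k w" "\<And>i. i < k \<Longrightarrow> w i \<in> W"
  shows "k \<le> fun_dim S W"
  unfolding fun_dim_def
  by (rule Greatest_le_nat [of _ _ "card S"]) (use assms orthonormal_family_card_le in blast)+

lemma fun_dim_attained:
  assumes "finite S"
  obtains w where "orthonormal_family S (fun_dim S W) w" "\<And>i. i < fun_dim S W \<Longrightarrow> w i \<in> W"
proof -
  have "\<exists>w. orthonormal_family S (fun_dim S W) w \<and> (\<forall>i<fun_dim S W. w i \<in> W)"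
    unfolding fun_dim_def
    \<comment> \<open>The empty family shows that some size occurs, and \<open>card S\<close> bounds
      all sizes.\<close>
    by (rule GreatestI_nat [of _ 0 "card S"])
      (use assms orthonormal_family_card_le in \<open>auto simp: orthonormal_family_def [of _ 0]\<close>)
  then show ?thesis using that by blast
qed

text \<open>A family of maximal size spans: a nonzero residual of \<open>f\<close>, once normalised,
  would extend the family by one more element of \<open>W\<close> and exceed
  \<open>fun_dim S W\<close>.\<close>

lemma orthonormal_expansion:
  assumes S: "finite S" and W: "fun_subspace S W"
    and w: "orthonormal_family S k w" "\<And>i. i < k \<Longrightarrow> w i \<in> W"
    and k: "fun_dim S W \<le> k" and f: "f \<in> W"
  shows "f = (\<lambda>x. \<Sum>i<k. fun_inner S f (w i) * w i x)"
proof (rule ccontr)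
  define r where "r = (\<lambda>x. f x - (\<Sum>i<k. fun_inner S f (w i) * w i x))"
  assume "\<not> ?thesis"
  then obtain x where x: "r x \<noteq> 0"
    by (auto simp: r_def fun_eq_iff)
  have rW: "r \<in> W"
    unfolding r_def by (intro fun_subspace_diff [OF W] f fun_subspace_sum [OF W] w)
  \<comment> \<open>Elements of \<open>W\<close> vanish outside \<open>S\<close>, so a nonzero
    residual is already nonzero at a point that \<open>norm_sq S\<close> sees.\<close>
  then have "x \<in> S"
    using fun_subspace_support [OF W] x by blast
  then have pos: "norm_sq S r > 0"
    using x norm_sq_eq_0_iff [OF S] norm_sq_nonneg by (metis less_eq_real_def)
  define s where "s = complex_of_real (1 / sqrt (norm_sq S r))"
  define v where "v = w(k := (\<lambda>x. s * r x))"
  have orth: "fun_inner S r (w j) = 0" "fun_inner S (w j) r = 0" if "j < k" for j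
    using norm_sq_orthogonal_residual(2) [OF w(1) that, of f]
    by (simp_all add: r_def fun_inner_commute [of S "w j"])
  have "fun_inner S (v k) (v k) = of_real ((1 / sqrt (norm_sq S r))\<^sup>2 * norm_sq S r)"
    unfolding fun_inner_self v_def fun_upd_same norm_sq_scale s_def norm_of_real power2_abs ..
  also have "(1 / sqrt (norm_sq S r))\<^sup>2 * norm_sq S r = 1"
    using pos by (simp add: power_divide)
  finally have "fun_inner S (v k) (v k) = 1"
    by simp
  moreover have "v i = w i" "fun_inner S (v i) (v k) = 0" "fun_inner S (v k) (v i) = 0" if "i < k" for i
    using that orth by (simp_all add: v_def fun_inner_scale_left fun_inner_scale_right)
  ultimately have "orthonormal_family S (Suc k) v"
    using w(1) by (auto simp: orthonormal_family_def less_Suc_eq)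
  moreover have "v i \<in> W" if "i < Suc k" for i
    using that w(2) fun_subspace_scale [OF W rW] by (auto simp: v_def less_Suc_eq)
  ultimately have "Suc k \<le> fun_dim S W"
    by (intro orthonormal_family_le_fun_dim S)
  with k show False by simp
qed

section \<open>Translation invariant subspaces and irreducible representations\<close>

text \<open>The value \<open>0\<close> outside the carrier keeps translates inside spaces of
  functions supported there. This is a left action: translating by \<open>h\<close> and then by
  \<open>g\<close> is translating by \<open>g \<otimes> h\<close>.\<close>

definition right_translate :: "('a, 'b) monoid_scheme \<Rightarrow> 'a \<Rightarrow> ('a \<Rightarrow> complex) \<Rightarrow> 'a \<Rightarrow> complex" where
  "right_translate G h f = (\<lambda>x. if x \<in> carrier G then f (x \<otimes>\<^bsub>G\<^esub> h) else 0)"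

definition translation_invariant :: "('a, 'b) monoid_scheme \<Rightarrow> ('a \<Rightarrow> complex) set \<Rightarrow> bool" where
  "translation_invariant G W \<longleftrightarrow> (\<forall>h\<in>carrier G. \<forall>f\<in>W. right_translate G h f \<in> W)"

lemma (in group) sum_right_mult:
  assumes "h \<in> carrier G"
  shows "(\<Sum>x\<in>carrier G. f (x \<otimes> h)) = (\<Sum>x\<in>carrier G. f x)"
  by (rule sum.reindex_bij_witness [of _ "\<lambda>x. x \<otimes> inv h" "\<lambda>x. x \<otimes> h"])
    (use assms in \<open>auto simp: m_assoc\<close>)

lemma (in group) norm_sq_right_translate:
  assumes "h \<in> carrier G"
  shows "norm_sq (carrier G) (right_translate G h f) = norm_sq (carrier G) f"
  using sum_right_mult [OF assms, of "\<lambda>x. (cmod (f x))\<^sup>2"]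
  by (simp add: norm_sq_def right_translate_def)

section \<open>The matrix representation on a translation invariant space\<close>

definition matrix_coefficient ::
  "('a, 'b) monoid_scheme \<Rightarrow> (nat \<Rightarrow> 'a \<Rightarrow> complex) \<Rightarrow> 'a \<Rightarrow> nat \<Rightarrow> nat \<Rightarrow> complex" where
  "matrix_coefficient G w h i j = fun_inner (carrier G) (right_translate G h (w j)) (w i)"

text \<open>Column \<open>j\<close> holds the coefficients of the translate of \<open>w j\<close>,
  so composing translations multiplies the matrices in the same order.\<close>

definition translation_matrix ::
  "('a, 'b) monoid_scheme \<Rightarrow> nat \<Rightarrow> (nat \<Rightarrow> 'a \<Rightarrow> complex) \<Rightarrow> 'a \<Rightarrow> complex mat" where
  "translation_matrix G k w h = Matrix.mat k k (\<lambda>(i, j). matrix_coefficient G w h i j)"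

text \<open>The map from coordinate vectors to functions; it transports subspaces of
  \<open>carrier_vec k\<close> to spaces of functions.\<close>

definition vec_combination :: "nat \<Rightarrow> (nat \<Rightarrow> 'a \<Rightarrow> complex) \<Rightarrow> complex Matrix.vec \<Rightarrow> 'a \<Rightarrow> complex" where
  "vec_combination k w u = (\<lambda>x. \<Sum>i<k. Matrix.vec_index u i * w i x)"

lemma vec_combination_inject:
  assumes "orthonormal_family S k w" "u \<in> carrier_vec k" "v \<in> carrier_vec k"
    and "vec_combination k w u = vec_combination k w v"
  shows "u = v"
proof (rule eq_vecI)
  fix i assume "i < dim_vec v"
  then have "i < k" using assms by simp
  then show "Matrix.vec_index u i = Matrix.vec_index v i"
    using orthonormal_coefficient [OF assms(1), of i "Matrix.vec_index u"]
      orthonormal_coefficient [OF assms(1), of i "Matrix.vec_index v"] assms(4)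
    by (simp add: vec_combination_def)
qed (use assms in simp)

text \<open>By \<open>dim_le\<close> the family has maximal size in \<open>W\<close>, so it is an
  orthonormal basis of a translation invariant space.\<close>

locale translation_basis = group G for G (structure) +
  fixes W :: "('a \<Rightarrow> complex) set" and w :: "nat \<Rightarrow> 'a \<Rightarrow> complex" and k :: nat
  assumes finite_carrier: "finite (carrier G)"
    and subspace: "fun_subspace (carrier G) W"
    and invariant: "translation_invariant G W"
    and orthonormal: "orthonormal_family (carrier G) k w"
    and basis_mem: "\<And>i. i < k \<Longrightarrow> w i \<in> W"
    and dim_le: "fun_dim (carrier G) W \<le> k"
begin

lemma expansion:
  assumes "f \<in> W"
  shows "f = (\<lambda>x. \<Sum>i<k. fun_inner (carrier G) f (w i) * w i x)"
  by (rule orthonormal_expansion) (fact finite_carrier subspace orthonormal basis_mem dim_le assms)+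

lemma right_translate_basis:
  assumes "h \<in> carrier G" "j < k"
  shows "right_translate G h (w j) = (\<lambda>x. \<Sum>i<k. matrix_coefficient G w h i j * w i x)"
  unfolding matrix_coefficient_def
  by (rule expansion) (use assms basis_mem invariant in \<open>auto simp: translation_invariant_def\<close>)

lemma right_translate_combination:
  "right_translate G h (\<lambda>x. \<Sum>j<k. c j * w j x) = (\<lambda>x. \<Sum>j<k. c j * right_translate G h (w j) x)"
  by (auto simp: right_translate_def)

lemma matrix_coefficient_mult:
  assumes "g \<in> carrier G" "h \<in> carrier G" "j < k"
  shows "matrix_coefficient G w (g \<otimes> h) i j
       = (\<Sum>l<k. matrix_coefficient G w g i l * matrix_coefficient G w h l j)"
proof -
  have "right_translate G (g \<otimes> h) (w j) = right_translate G g (right_translate G h (w j))"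
    using assms by (auto simp: right_translate_def m_assoc)
  also have "\<dots> = (\<lambda>x. \<Sum>l<k. matrix_coefficient G w h l j * right_translate G g (w l) x)"
    using assms by (simp add: right_translate_basis [of h] right_translate_combination)
  finally show ?thesis
    unfolding matrix_coefficient_def [of _ _ "g \<otimes> h"]
    by (simp add: fun_inner_sum_left matrix_coefficient_def [of _ _ g] mult.commute)
qed

lemma matrix_coefficient_one:
  assumes "i < k" "j < k"
  shows "matrix_coefficient G w \<one> i j = (if i = j then 1 else 0)"
proof -
  have "matrix_coefficient G w \<one> i j = fun_inner (carrier G) (w j) (w i)"
    by (simp add: matrix_coefficient_def right_translate_def fun_inner_def)
  then show ?thesis
    using assms orthonormal by (auto simp: orthonormal_family_def)
qed

lemma translation_matrix_mult:
  assumes "g \<in> carrier G" "h \<in> carrier G"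
  shows "translation_matrix G k w (g \<otimes> h) = translation_matrix G k w g * translation_matrix G k w h"
  using assms
  by (intro eq_matI)
    (auto simp: translation_matrix_def scalar_prod_def matrix_coefficient_mult atLeast0LessThan)

lemma translation_matrix_one: "translation_matrix G k w \<one> = 1\<^sub>m k"
  by (intro eq_matI) (auto simp: translation_matrix_def matrix_coefficient_one)

lemma representation_translation_matrix: "representation G k (translation_matrix G k w)"
proof -
  have "translation_matrix G k w g \<in> Units (ring_mat TYPE(complex) k ())" if "g \<in> carrier G" for g
  proof -
    have "translation_matrix G k w g * translation_matrix G k w (inv g) = 1\<^sub>m k"
      "translation_matrix G k w (inv g) * translation_matrix G k w g = 1\<^sub>m k"
      using that by (simp_all add: translation_matrix_one flip: translation_matrix_mult)
    moreover have "translation_matrix G k w h \<in> carrier_mat k k" for h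
      by (simp add: translation_matrix_def)
    ultimately show ?thesis
      unfolding Units_def by (auto simp: ring_mat_simps)
  qed
  then show ?thesis
    unfolding representation_def GL_def
    by (auto intro!: homI simp: units_of_def ring_mat_simps translation_matrix_mult)
qed

text \<open>The coordinate map intertwines the matrix representation with right translation, which
  lets invariant subspaces pass from coordinates to functions.\<close>

lemma right_translate_vec_combination:
  assumes "h \<in> carrier G" "u \<in> carrier_vec k"
  shows "right_translate G h (vec_combination k w u)
       = vec_combination k w (translation_matrix G k w h *\<^sub>v u)"
proof
  fix x
  have "right_translate G h (vec_combination k w u) x
      = (\<Sum>j<k. Matrix.vec_index u j * (\<Sum>i<k. matrix_coefficient G w h i j * w i x))"
    unfolding vec_combination_def using assms
    by (simp add: right_translate_combination right_translate_basis)
  also have "\<dots> = (\<Sum>i<k. (\<Sum>j<k. matrix_coefficient G w h i j * Matrix.vec_index u j) * w i x)"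
    unfolding sum_distrib_left sum_distrib_right
    by (subst sum.swap) (simp add: mult.left_commute mult.assoc)
  also have "\<dots> = vec_combination k w (translation_matrix G k w h *\<^sub>v u) x"
    using assms unfolding vec_combination_def
    by (intro sum.cong) (auto simp: translation_matrix_def scalar_prod_def atLeast0LessThan)
  finally show "right_translate G h (vec_combination k w u) x
      = vec_combination k w (translation_matrix G k w h *\<^sub>v u) x" .
qed

text \<open>An invariant subspace \<open>U\<close> of coordinate vectors has as its image a
  translation invariant subspace \<open>W'\<close> of \<open>W\<close>. If \<open>W'\<close> is
  nonzero, minimality gives it the full dimension; injectivity of the coordinate map carries both
  alternatives back to \<open>U\<close>.\<close>

lemma irreducible_translation_matrix:
  assumes "k > 0"
    and minimal: "\<And>W'. fun_subspace (carrier G) W' \<Longrightarrow> translation_invariant G W' \<Longrightarrow> W' \<subseteq> W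
      \<Longrightarrow> W' \<noteq> {\<lambda>_. 0} \<Longrightarrow> fun_dim (carrier G) W \<le> fun_dim (carrier G) W'"
  shows "irreducible_representation G k (translation_matrix G k w)"
  unfolding irreducible_representation_def
proof (intro conjI allI impI representation_translation_matrix \<open>k > 0\<close>)
  fix U assume U: "invariant_subspace G k (translation_matrix G k w) U"
  then have sub: "U \<subseteq> carrier_vec k" and zero: "0\<^sub>v k \<in> U"
    and add: "\<And>u v. u \<in> U \<Longrightarrow> v \<in> U \<Longrightarrow> u + v \<in> U"
    and scale: "\<And>c u. u \<in> U \<Longrightarrow> c \<cdot>\<^sub>v u \<in> U"
    and inv: "\<And>h u. h \<in> carrier G \<Longrightarrow> u \<in> U \<Longrightarrow> translation_matrix G k w h *\<^sub>v u \<in> U"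
    unfolding invariant_subspace_def VectorSpace.subspace_def submodule_def
    by (simp_all add: module_vec_simps)
  define W' where "W' = vec_combination k w ` U"
  have memW: "vec_combination k w u \<in> W" for u
    unfolding vec_combination_def by (intro fun_subspace_sum [OF subspace] basis_mem)
  have W'W: "W' \<subseteq> W"
    by (auto simp: W'_def memW)
  have W': "fun_subspace (carrier G) W'"
    unfolding fun_subspace_def
  proof (intro conjI ballI allI impI)
    have "vec_combination k w (0\<^sub>v k) = (\<lambda>_. 0)"
      by (simp add: vec_combination_def)
    then show "(\<lambda>_. 0) \<in> W'"
      using zero unfolding W'_def by (metis imageI)
  next
    fix f g assume "f \<in> W'" "g \<in> W'"
    then obtain u v where uv: "u \<in> U" "v \<in> U" "f = vec_combination k w u" "g = vec_combination k w v"
      by (auto simp: W'_def)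
    moreover from uv have "u \<in> carrier_vec k" "v \<in> carrier_vec k"
      using sub by auto
    ultimately have "(\<lambda>x. f x + g x) = vec_combination k w (u + v)"
      by (simp add: fun_eq_iff vec_combination_def distrib_right sum.distrib)
    then show "(\<lambda>x. f x + g x) \<in> W'"
      using add uv unfolding W'_def by blast
  next
    fix c f assume "f \<in> W'"
    then obtain u where u: "u \<in> U" "f = vec_combination k w u"
      by (auto simp: W'_def)
    moreover from u have "u \<in> carrier_vec k"
      using sub by auto
    ultimately have "(\<lambda>x. c * f x) = vec_combination k w (c \<cdot>\<^sub>v u)"
      by (simp add: fun_eq_iff vec_combination_def sum_distrib_left mult.assoc)
    then show "(\<lambda>x. c * f x) \<in> W'"
      using scale u unfolding W'_def by blast
  next
    fix f x assume "f \<in> W'" "x \<notin> carrier G"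
    then show "f x = 0"
      using W'W fun_subspace_support [OF subspace] by blast
  qed
  have inv': "translation_invariant G W'"
    unfolding translation_invariant_def W'_def
    using right_translate_vec_combination inv sub by (auto simp: subset_iff)
  show "U = {0\<^sub>v k} \<or> U = carrier_vec k"
  proof (cases "W' = {\<lambda>_. 0}")
    case True
    have "u = 0\<^sub>v k" if "u \<in> U" for u
    proof (rule vec_combination_inject [OF orthonormal])
      have "vec_combination k w v \<in> W'" if "v \<in> U" for v
        using that by (simp add: W'_def)
      then show "vec_combination k w u = vec_combination k w (0\<^sub>v k)"
        using True that zero by auto
    qed (use that sub in auto)
    then have "U = {0\<^sub>v k}"
      using zero by blast
    then show ?thesis ..
  next
    case False
    obtain v where v: "orthonormal_family (carrier G) (fun_dim (carrier G) W') v"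
      "\<And>i. i < fun_dim (carrier G) W' \<Longrightarrow> v i \<in> W'"
      using fun_dim_attained [OF finite_carrier] by blast
    have "W \<subseteq> W'"
    proof
      fix f assume f: "f \<in> W"
      \<comment> \<open>By minimality a largest orthonormal family of \<open>W'\<close> is also
        large enough to span \<open>W\<close>.\<close>
      have "f = (\<lambda>x. \<Sum>i<fun_dim (carrier G) W'. fun_inner (carrier G) f (v i) * v i x)"
        using v W'W by (intro orthonormal_expansion [OF finite_carrier subspace] f
            minimal W' inv' False) auto
      also have "\<dots> \<in> W'"
        by (intro fun_subspace_sum [OF W'] v)
      finally show "f \<in> W'" .
    qed
    have "u \<in> U" if "u \<in> carrier_vec k" for u
    proof -
      obtain u' where "u' \<in> U" "vec_combination k w u = vec_combination k w u'"
        using memW [of u] \<open>W \<subseteq> W'\<close> by (auto simp: W'_def)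
      then show ?thesis
        using vec_combination_inject [OF orthonormal that] sub by blast
    qed
    then have "U = carrier_vec k"
      using sub by blast
    then show ?thesis ..
  qed
qed

text \<open>In the trivial representation the single basis function is translation invariant, hence
  constant on the group. Mean zero makes the constant zero, contradicting norm one.\<close>

lemma not_trivial_translation_matrix:
  assumes "\<And>f. f \<in> W \<Longrightarrow> (\<Sum>x\<in>carrier G. f x) = 0"
  shows "\<not> trivial_representation G k (translation_matrix G k w)"
proof
  assume "trivial_representation G k (translation_matrix G k w)"
  then have k: "k = 1" and "\<And>h. h \<in> carrier G \<Longrightarrow> translation_matrix G k w h = 1\<^sub>m 1"
    by (auto simp: trivial_representation_def)
  then have "matrix_coefficient G w h 0 0 = 1" if "h \<in> carrier G" for h
    using that index_mat(1) [of 0 k 0 k "\<lambda>(i, j). matrix_coefficient G w h i j"]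
    by (auto simp: translation_matrix_def [abs_def])
  \<comment> \<open>Evaluating at \<open>\<one>\<close> suffices, because the translate by
    \<open>h\<close> takes there the value \<open>w 0 h\<close>.\<close>
  then have translate: "right_translate G h (w 0) \<one> = w 0 \<one>" if "h \<in> carrier G" for h
    using that right_translate_basis [of h 0] by (simp add: k)
  define c where "c = w 0 \<one>"
  have const: "w 0 h = c" if "h \<in> carrier G" for h
    using translate [OF that] that by (simp add: right_translate_def c_def)
  have "(\<Sum>x\<in>carrier G. w 0 x) = 0"
    using assms basis_mem k by simp
  then have "of_nat (card (carrier G)) * c = 0"
    by (simp add: const)
  then have "c = 0"
    using finite_carrier by auto
  then have "fun_inner (carrier G) (w 0) (w 0) = 0"
    using const by (simp add: fun_inner_def)
  then show False
    using orthonormal [unfolded orthonormal_family_def, rule_format, of 0 0] k by simp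
qed

end

text \<open>Among the nonzero invariant subspaces of \<open>W\<close> one of least dimension carries
  an irreducible representation, nontrivial by mean zero, so \<open>d_min G\<close> is at most its
  dimension. The existence of this representation also means that the \<open>LEAST\<close> in
  \<open>d_min\<close> is attained, hence positive.\<close>

lemma (in group) d_min_le_fun_dim:
  assumes fin: "finite (carrier G)"
    and W: "fun_subspace (carrier G) W" "translation_invariant G W" "W \<noteq> {\<lambda>_. 0}"
    and mean: "\<And>f. f \<in> W \<Longrightarrow> (\<Sum>x\<in>carrier G. f x) = 0"
  shows "0 < d_min G" and "d_min G \<le> fun_dim (carrier G) W"
proof -
  define P where "P V \<longleftrightarrow> fun_subspace (carrier G) V \<and> translation_invariant G V \<and> V \<subseteq> W \<and> V \<noteq> {\<lambda>_. 0}" for V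
  have "P W"
    using W by (simp add: P_def)
  then obtain V where V: "P V" and least: "\<And>V'. P V' \<Longrightarrow> fun_dim (carrier G) V \<le> fun_dim (carrier G) V'"
    using ex_has_least_nat [of P W "fun_dim (carrier G)"] by blast
  define k where "k = fun_dim (carrier G) V"
  obtain w where w: "orthonormal_family (carrier G) k w" "\<And>i. i < k \<Longrightarrow> w i \<in> V"
    unfolding k_def using fun_dim_attained [OF fin] by blast
  interpret translation_basis G V w k
    by unfold_locales (use fin V w in \<open>auto simp: P_def k_def\<close>)
  have "k > 0"
  proof (rule ccontr)
    assume "\<not> k > 0"
    then have "f = (\<lambda>_. 0)" if "f \<in> V" for f
      using expansion [OF that] by simp
    then show False
      using V fun_subspace_zero by (auto simp: P_def)
  qed
  have irr: "irreducible_representation G k (translation_matrix G k w)"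
    using least V by (intro irreducible_translation_matrix \<open>k > 0\<close>) (auto simp: P_def)
  have nontriv: "\<not> trivial_representation G k (translation_matrix G k w)"
    using mean V by (intro not_trivial_translation_matrix) (auto simp: P_def)
  have "d_min G \<le> k"
    unfolding d_min_def by (rule Least_le) (use irr nontriv in blast)
  then show "d_min G \<le> fun_dim (carrier G) W"
    using least [OF \<open>P W\<close>] by (simp add: k_def)
  have "\<exists>\<rho>. irreducible_representation G (d_min G) \<rho> \<and> \<not> trivial_representation G (d_min G) \<rho>"
    unfolding d_min_def by (rule LeastI) (use irr nontriv in blast)
  then show "0 < d_min G"
    unfolding irreducible_representation_def by blast
qed

section \<open>Convolution with mean zero functions\<close>

definition mean_zero :: "'a set \<Rightarrow> ('a \<Rightarrow> complex) set" where
  "mean_zero S = {h. (\<forall>x. x \<notin> S \<longrightarrow> h x = 0) \<and> (\<Sum>x\<in>S. h x) = 0}"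

lemma fun_subspace_mean_zero: "fun_subspace S (mean_zero S)"
  by (simp add: fun_subspace_def mean_zero_def sum.distrib sum_distrib_left [symmetric])

lemma (in group) right_translate_mean_zero:
  assumes "h \<in> carrier G" "f \<in> mean_zero (carrier G)"
  shows "right_translate G h f \<in> mean_zero (carrier G)"
  using assms sum_right_mult [of h f] by (simp add: mean_zero_def right_translate_def)

text \<open>Functions carry the product topology over the whole type, which may be infinite. The
  sphere is cut out by closed conditions from a product of closed unit discs, which is compact by
  Tychonoff.\<close>

lemma compact_mean_zero_sphere:
  assumes "finite S"
  shows "compact {h \<in> mean_zero S. norm_sq S h = 1}"
proof -
  let ?B = "{h \<in> mean_zero S. norm_sq S h = 1}"
  have cont: "continuous_on UNIV (\<lambda>h :: 'a \<Rightarrow> complex. h x)" for x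
    by (rule continuous_on_product_coordinates)
  let ?K = "PiE UNIV (\<lambda>_ :: 'a. cball (0 :: complex) 1)"
  have "closed ((\<Inter>x\<in>-S. {h :: 'a \<Rightarrow> complex. h x = 0}) \<inter> {h. (\<Sum>x\<in>S. h x) = 0} \<inter> {h. norm_sq S h = 1})"
    unfolding norm_sq_def
    by (intro closed_Int closed_INT ballI closed_Collect_eq continuous_intros cont)
  moreover have "?B = (\<Inter>x\<in>-S. {h. h x = 0}) \<inter> {h. (\<Sum>x\<in>S. h x) = 0} \<inter> {h. norm_sq S h = 1}"
    by (auto simp: mean_zero_def)
  ultimately have "closed ?B"
    by simp
  moreover have "compact ?K"
    using compactin_PiE [of "\<lambda>_. euclidean" UNIV "\<lambda>_ :: 'a. cball (0 :: complex) 1"]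
    by (simp add: euclidean_product_topology)
  ultimately have "compact (?K \<inter> ?B)"
    by (intro compact_Int_closed)
  moreover have "?B \<subseteq> ?K"
  proof
    fix h assume h: "h \<in> ?B"
    have "cmod (h x) \<le> 1" for x
    proof (cases "x \<in> S")
      case True
      then have "(cmod (h x))\<^sup>2 \<le> norm_sq S h"
        unfolding norm_sq_def using assms by (intro member_le_sum) auto
      then show ?thesis
        using h by (simp add: power_le_one_iff abs_square_le_1)
    qed (use h in \<open>simp add: mean_zero_def\<close>)
    then show "h \<in> ?K"
      by auto
  qed
  ultimately show ?thesis
    by (simp only: inf.absorb2)
qed

section \<open>Convolution as an operator commuting with right translation\<close>

definition group_convolution ::
  "('a, 'b) monoid_scheme \<Rightarrow> ('a \<Rightarrow> complex) \<Rightarrow> ('a \<Rightarrow> complex) \<Rightarrow> 'a \<Rightarrow> complex" where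
  "group_convolution G f g y = (\<Sum>z\<in>carrier G. f (y \<otimes>\<^bsub>G\<^esub> inv\<^bsub>G\<^esub> z) * g z)"

lemma group_convolution_add:
  "group_convolution G f (\<lambda>x. g x + h x) = (\<lambda>y. group_convolution G f g y + group_convolution G f h y)"
  by (simp add: fun_eq_iff group_convolution_def algebra_simps sum.distrib)

lemma group_convolution_diff:
  "group_convolution G f (\<lambda>x. g x - h x) = (\<lambda>y. group_convolution G f g y - group_convolution G f h y)"
  by (simp add: fun_eq_iff group_convolution_def algebra_simps sum_subtractf)

lemma group_convolution_scale:
  "group_convolution G f (\<lambda>x. c * g x) = (\<lambda>y. c * group_convolution G f g y)"
  by (simp add: fun_eq_iff group_convolution_def algebra_simps sum_distrib_left)

text \<open>Replacing \<open>z\<close> by \<open>z \<otimes> h\<close> and \<open>y\<close> by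
  \<open>y \<otimes> h\<close> leaves \<open>y \<otimes> inv z\<close> unchanged.\<close>

lemma (in group) group_convolution_right_translate:
  assumes "h \<in> carrier G" "y \<in> carrier G"
  shows "group_convolution G f (right_translate G h g) y = group_convolution G f g (y \<otimes> h)"
proof -
  have "group_convolution G f (right_translate G h g) y
      = (\<Sum>z\<in>carrier G. f (y \<otimes> h \<otimes> inv (z \<otimes> h)) * g (z \<otimes> h))"
    unfolding group_convolution_def
  proof (rule sum.cong)
    fix z assume z: "z \<in> carrier G"
    have "y \<otimes> h \<otimes> inv (z \<otimes> h) = y \<otimes> inv z"
      using assms z by (simp add: inv_mult_group m_assoc) (simp flip: m_assoc)
    then show "f (y \<otimes> inv z) * right_translate G h g z = f (y \<otimes> h \<otimes> inv (z \<otimes> h)) * g (z \<otimes> h)"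
      using z by (simp add: right_translate_def)
  qed simp
  also have "\<dots> = group_convolution G f g (y \<otimes> h)"
    unfolding group_convolution_def by (rule sum_right_mult [OF assms(1)])
  finally show ?thesis .
qed

lemma (in group) norm_sq_group_convolution_right_translate:
  assumes "h \<in> carrier G"
  shows "norm_sq (carrier G) (group_convolution G f (right_translate G h g))
       = norm_sq (carrier G) (group_convolution G f g)"
  using sum_right_mult [OF assms, of "\<lambda>y. (cmod (group_convolution G f g y))\<^sup>2"] assms
  by (simp add: norm_sq_def group_convolution_right_translate)

text \<open>For fixed \<open>z\<close> the argument \<open>y \<otimes> inv z\<close> runs once
  through the group, so each column of the convolution kernel contributes the squared norm of
  \<open>f\<close>.\<close>

lemma (in group) sum_convolution_kernel:
  assumes "finite (carrier G)"
  shows "(\<Sum>y\<in>carrier G. \<Sum>z\<in>carrier G. (cmod (f (y \<otimes> inv z)))\<^sup>2)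
       = real (card (carrier G)) * norm_sq (carrier G) f"
proof -
  have "(\<Sum>y\<in>carrier G. (cmod (f (y \<otimes> inv z)))\<^sup>2) = norm_sq (carrier G) f" if "z \<in> carrier G" for z
    unfolding norm_sq_def using sum_right_mult [of "inv z" "\<lambda>x. (cmod (f x))\<^sup>2"] that by simp
  then show ?thesis
    by (subst sum.swap) simp
qed

lemma group_convolution_restrict:
  "group_convolution G f (\<lambda>x. if x \<in> carrier G then g x else 0) = group_convolution G f g"
  by (simp add: fun_eq_iff group_convolution_def)

text \<open>The maximisers of the quotient \<open>|f * g|\<^sup>2 / |g|\<^sup>2\<close> form a translation invariant subspace, by the
  parallelogram law. Its dimension, which is at least \<open>d_min G\<close>, times the maximum is bounded by the
  Hilbert--Schmidt norm of the convolution operator.\<close>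
lemma (in group) convolution_bound:
  assumes fin: "finite (carrier G)" and mean: "(\<Sum>x\<in>carrier G. g x) = 0"
  shows "real (d_min G) * norm_sq (carrier G) (group_convolution G f g)
       \<le> real (card (carrier G)) * norm_sq (carrier G) f * norm_sq (carrier G) g"
proof (cases "norm_sq (carrier G) g = 0")
  case True
  then have "norm_sq (carrier G) (group_convolution G f g) = 0"
    using norm_sq_eq_0_iff [OF fin] by (simp add: group_convolution_def)
  with True show ?thesis by simp
next
  case False
  let ?C = "carrier G" and ?T = "group_convolution G f"
  define B where "B = {h \<in> mean_zero ?C. norm_sq ?C h = 1}"
  have normalize: "\<exists>c. (\<lambda>x. c * h x) \<in> B \<and> norm_sq ?C h * (cmod c)\<^sup>2 = 1"
    if h: "h \<in> mean_zero ?C" "norm_sq ?C h \<noteq> 0" for h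
  proof -
    define c where "c = complex_of_real (1 / sqrt (norm_sq ?C h))"
    have "(cmod c)\<^sup>2 = 1 / norm_sq ?C h"
      unfolding c_def norm_of_real power2_abs by (simp add: power_divide norm_sq_nonneg)
    then have "norm_sq ?C h * (cmod c)\<^sup>2 = 1"
      using h by simp
    moreover from this have "(\<lambda>x. c * h x) \<in> B"
      using fun_subspace_scale [OF fun_subspace_mean_zero h(1)]
      by (simp add: B_def norm_sq_scale mult.commute)
    ultimately show ?thesis by blast
  qed
  \<comment> \<open>Values of \<open>g\<close> off the carrier are arbitrary; cutting them off puts
    the function into \<open>mean_zero\<close> and changes neither its norm nor its
    convolution.\<close>
  define g' where "g' = (\<lambda>x. if x \<in> ?C then g x else 0)"
  have g': "g' \<in> mean_zero ?C" "norm_sq ?C g' = norm_sq ?C g" "?T g' = ?T g"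
    using mean by (simp_all add: g'_def mean_zero_def norm_sq_def group_convolution_restrict)
  have "B \<noteq> {}"
    using normalize [OF g'(1)] g'(2) False by auto
  moreover have "continuous_on B (\<lambda>h. norm_sq ?C (?T h))"
    unfolding norm_sq_def group_convolution_def
    by (intro continuous_intros continuous_on_subset [OF continuous_on_product_coordinates]) auto
  ultimately obtain m where m: "m \<in> B" and max: "\<And>h. h \<in> B \<Longrightarrow> norm_sq ?C (?T h) \<le> norm_sq ?C (?T m)"
    using continuous_attains_sup [of B] compact_mean_zero_sphere [OF fin] unfolding B_def by blast
  define \<mu> where "\<mu> = norm_sq ?C (?T m)"
  have bound: "norm_sq ?C (?T h) \<le> \<mu> * norm_sq ?C h" if h: "h \<in> mean_zero ?C" for h
  proof (cases "norm_sq ?C h = 0")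
    case True
    then have "norm_sq ?C (?T h) = 0"
      using norm_sq_eq_0_iff [OF fin] by (simp add: group_convolution_def)
    with True show ?thesis by simp
  next
    case False
    then obtain c where c: "(\<lambda>x. c * h x) \<in> B" "norm_sq ?C h * (cmod c)\<^sup>2 = 1"
      using normalize h by blast
    have "(cmod c)\<^sup>2 * norm_sq ?C (?T h) \<le> \<mu>"
      using max [OF c(1)] by (simp add: group_convolution_scale norm_sq_scale \<mu>_def)
    then have "norm_sq ?C h * ((cmod c)\<^sup>2 * norm_sq ?C (?T h)) \<le> norm_sq ?C h * \<mu>"
      by (intro mult_left_mono norm_sq_nonneg)
    then show ?thesis
      using c(2) by (simp add: mult.commute flip: mult.assoc)
  qed
  define E where "E = {h \<in> mean_zero ?C. norm_sq ?C (?T h) = \<mu> * norm_sq ?C h}"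
  have E: "fun_subspace ?C E"
    unfolding fun_subspace_def
  proof (intro conjI ballI allI impI)
    have "?T (\<lambda>_. 0) = (\<lambda>_. 0)"
      by (simp add: fun_eq_iff group_convolution_def)
    then show "(\<lambda>_. 0) \<in> E"
      using fun_subspace_zero [OF fun_subspace_mean_zero] by (simp add: E_def norm_sq_def)
  next
    fix u v assume u: "u \<in> E" and v: "v \<in> E"
    then have mem: "(\<lambda>x. u x + v x) \<in> mean_zero ?C" "(\<lambda>x. u x - v x) \<in> mean_zero ?C"
      using fun_subspace_add fun_subspace_diff fun_subspace_mean_zero unfolding E_def by blast+
    have "norm_sq ?C (?T (\<lambda>x. u x + v x)) + norm_sq ?C (?T (\<lambda>x. u x - v x))
        = \<mu> * (2 * norm_sq ?C u + 2 * norm_sq ?C v)"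
      using u v unfolding group_convolution_add group_convolution_diff norm_sq_parallelogram
      by (simp add: E_def algebra_simps)
    also have "\<dots> = \<mu> * norm_sq ?C (\<lambda>x. u x + v x) + \<mu> * norm_sq ?C (\<lambda>x. u x - v x)"
      by (simp only: norm_sq_parallelogram distrib_left [symmetric])
    \<comment> \<open>The upper bounds for the sum and for the difference add up to an equality, so
      each of them is an equality.\<close>
    finally show "(\<lambda>x. u x + v x) \<in> E"
      using bound [OF mem(1)] bound [OF mem(2)] mem by (simp add: E_def)
  next
    fix c u assume "u \<in> E"
    then show "(\<lambda>x. c * u x) \<in> E"
      using fun_subspace_scale [OF fun_subspace_mean_zero, of u ?C c]
      by (simp add: E_def group_convolution_scale norm_sq_scale)
  next
    fix u x assume "u \<in> E" "x \<notin> ?C"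
    then show "u x = 0"
      by (simp add: E_def mean_zero_def)
  qed
  have inv: "translation_invariant G E"
    by (simp add: translation_invariant_def E_def right_translate_mean_zero norm_sq_right_translate
        norm_sq_group_convolution_right_translate)
  have "m \<in> E"
    using m by (simp add: E_def B_def \<mu>_def)
  moreover have "m \<noteq> (\<lambda>_. 0)"
    using m by (auto simp: B_def norm_sq_def)
  ultimately have "d_min G \<le> fun_dim ?C E"
    by (intro d_min_le_fun_dim fin E inv) (auto simp: E_def mean_zero_def)
  obtain w where w: "orthonormal_family ?C (fun_dim ?C E) w" "\<And>i. i < fun_dim ?C E \<Longrightarrow> w i \<in> E"
    using fun_dim_attained [OF fin] by blast
  have "norm_sq ?C (?T (w i)) = \<mu>" if "i < fun_dim ?C E" for i
  proof -
    have "complex_of_real (norm_sq ?C (w i)) = 1"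
      using w(1) that by (simp add: orthonormal_family_def flip: fun_inner_self)
    then show ?thesis
      using w(2) [OF that] by (simp add: E_def)
  qed
  then have "real (fun_dim ?C E) * \<mu> = (\<Sum>i<fun_dim ?C E. norm_sq ?C (?T (w i)))"
    by simp
  also have "\<dots> \<le> real (card ?C) * norm_sq ?C f"
    using sum_norm_sq_kernel_le [OF w(1), of "\<lambda>y z. f (y \<otimes> inv z)"] sum_convolution_kernel [OF fin, of f]
    by (simp add: group_convolution_def [abs_def])
  finally have "real (fun_dim ?C E) * \<mu> \<le> real (card ?C) * norm_sq ?C f" .
  moreover have "real (d_min G) * \<mu> \<le> real (fun_dim ?C E) * \<mu>"
    using \<open>d_min G \<le> fun_dim ?C E\<close> by (intro mult_right_mono) (simp_all add: \<mu>_def norm_sq_nonneg)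
  ultimately have "real (d_min G) * \<mu> * norm_sq ?C g \<le> real (card ?C) * norm_sq ?C f * norm_sq ?C g"
    by (intro mult_right_mono norm_sq_nonneg) simp
  moreover have "norm_sq ?C (?T g) \<le> \<mu> * norm_sq ?C g"
    using bound [OF g'(1)] g' by simp
  then have "real (d_min G) * norm_sq ?C (?T g) \<le> real (d_min G) * (\<mu> * norm_sq ?C g)"
    by (intro mult_left_mono) simp_all
  ultimately show ?thesis
    by (simp add: mult.assoc)
qed

text \<open>The space of all mean zero functions is invariant, and it is nonzero because the group
  has an element other than \<open>\<one>\<close>.\<close>

lemma (in group) d_min_pos:
  assumes "finite (carrier G)" "carrier G \<noteq> {\<one>}"
  shows "0 < d_min G"
proof (rule d_min_le_fun_dim(1) [OF assms(1) fun_subspace_mean_zero])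
  show "translation_invariant G (mean_zero (carrier G))"
    by (simp add: translation_invariant_def right_translate_mean_zero)
  obtain a where a: "a \<in> carrier G" "a \<noteq> \<one>"
    using assms(2) by blast
  \<comment> \<open>A difference of two point masses has mean zero without vanishing.\<close>
  define h :: "'a \<Rightarrow> complex" where "h = (\<lambda>x. (if x = a then 1 else 0) - (if x = \<one> then 1 else 0))"
  have "h \<in> mean_zero (carrier G)"
    using a assms(1) by (auto simp: h_def mean_zero_def sum_subtractf)
  moreover have "h a \<noteq> 0"
    using a by (simp add: h_def)
  ultimately show "mean_zero (carrier G) \<noteq> {\<lambda>_. 0}"
    by auto
qed (simp add: mean_zero_def)

section \<open>Matrix-valued functions\<close>

lemma sum_swap_pair:
  "(\<Sum>x\<in>A. \<Sum>y\<in>B. \<Sum>i\<in>I. g x y i) = (\<Sum>i\<in>I. \<Sum>x\<in>A. \<Sum>y\<in>B. g x y i)"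
  by (subst sum.swap, subst (2) sum.swap) (simp add: sum.swap [of _ I A])

lemma sum_sum_mult_le:
  fixes a b :: "'m::finite \<Rightarrow> 'n::finite \<Rightarrow> real"
  shows "(\<Sum>i\<in>UNIV. \<Sum>j\<in>UNIV. a i j * b i j)\<^sup>2
       \<le> (\<Sum>i\<in>UNIV. \<Sum>j\<in>UNIV. (a i j)\<^sup>2) * (\<Sum>i\<in>UNIV. \<Sum>j\<in>UNIV. (b i j)\<^sup>2)"
  using Cauchy_Schwarz_ineq_sum [of "\<lambda>(i, j). a i j" "\<lambda>(i, j). b i j" "UNIV \<times> UNIV"]
  by (simp only: sum.cartesian_product case_prod_unfold)

text \<open>The sum is the Frobenius inner product of \<open>a\<close> with its matrix square
  \<open>b\<close>. Cauchy-Schwarz bounds it by the product of their norms, and a second use on each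
  entry of \<open>b\<close> gives submultiplicativity of the Frobenius norm.\<close>

lemma sum_cyclic_product_le:
  fixes a :: "'n::finite \<Rightarrow> 'n \<Rightarrow> real"
  shows "(\<Sum>i\<in>UNIV. \<Sum>j\<in>UNIV. \<Sum>k\<in>UNIV. a i j * (a i k * a k j))
       \<le> (sqrt (\<Sum>i\<in>UNIV. \<Sum>j\<in>UNIV. (a i j)\<^sup>2)) ^ 3"
proof -
  define s where "s = (\<Sum>i\<in>UNIV. \<Sum>j\<in>UNIV. (a i j)\<^sup>2)"
  define b where "b i j = (\<Sum>k\<in>UNIV. a i k * a k j)" for i j
  have s: "s \<ge> 0"
    unfolding s_def by (intro sum_nonneg) simp
  have "(\<Sum>i\<in>UNIV. \<Sum>j\<in>UNIV. (b i j)\<^sup>2)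
      \<le> (\<Sum>i\<in>UNIV. \<Sum>j\<in>UNIV. (\<Sum>k\<in>UNIV. (a i k)\<^sup>2) * (\<Sum>k\<in>UNIV. (a k j)\<^sup>2))"
    unfolding b_def by (intro sum_mono Cauchy_Schwarz_ineq_sum)
  also have "\<dots> = (\<Sum>i\<in>UNIV. \<Sum>k\<in>UNIV. (a i k)\<^sup>2) * (\<Sum>j\<in>UNIV. \<Sum>k\<in>UNIV. (a k j)\<^sup>2)"
    by (rule sum_product [symmetric])
  also have "(\<Sum>j\<in>UNIV. \<Sum>k\<in>UNIV. (a k j)\<^sup>2) = s"
    unfolding s_def by (rule sum.swap)
  also have "(\<Sum>i\<in>UNIV. \<Sum>k\<in>UNIV. (a i k)\<^sup>2) = s"
    by (simp add: s_def)
  finally have b: "(\<Sum>i\<in>UNIV. \<Sum>j\<in>UNIV. (b i j)\<^sup>2) \<le> s * s" .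
  have "(\<Sum>i\<in>UNIV. \<Sum>j\<in>UNIV. a i j * b i j)\<^sup>2 \<le> s * (\<Sum>i\<in>UNIV. \<Sum>j\<in>UNIV. (b i j)\<^sup>2)"
    unfolding s_def by (rule sum_sum_mult_le)
  also have "\<dots> \<le> s * (s * s)"
    by (intro mult_left_mono b s)
  also have "\<dots> = (sqrt s ^ 3)\<^sup>2"
    using s by (simp add: power3_eq_cube power_mult_distrib power2_eq_square)
  finally have "(\<Sum>i\<in>UNIV. \<Sum>j\<in>UNIV. a i j * b i j) \<le> sqrt s ^ 3"
    by (rule power2_le_imp_le) (use s in simp)
  then show ?thesis
    by (simp add: s_def b_def sum_distrib_left)
qed

section \<open>Trilinear estimates for mean zero functions\<close>

lemma (in group) sum_left_mult:
  assumes "g \<in> carrier G"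
  shows "(\<Sum>x\<in>carrier G. f (g \<otimes> x)) = (\<Sum>x\<in>carrier G. f x)"
  by (rule sum.reindex_bij_witness [of _ "\<lambda>x. inv g \<otimes> x" "\<lambda>x. g \<otimes> x"])
    (use assms in \<open>auto simp flip: m_assoc\<close>)

lemma sum_inner_complex_le:
  "(\<Sum>x\<in>S. f x \<bullet> g x) \<le> sqrt (norm_sq S f) * sqrt (norm_sq S g)" for f g :: "'a \<Rightarrow> complex"
proof -
  have "(\<Sum>x\<in>S. f x \<bullet> g x) \<le> (\<Sum>x\<in>S. \<bar>cmod (f x)\<bar> * \<bar>cmod (g x)\<bar>)"
    by (intro sum_mono) (simp add: norm_cauchy_schwarz)
  also have "\<dots> \<le> sqrt (norm_sq S f) * sqrt (norm_sq S g)"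
    using L2_set_mult_ineq [of "\<lambda>x. cmod (f x)" "\<lambda>x. cmod (g x)" S] by (simp add: L2_set_def norm_sq_def)
  finally show ?thesis .
qed

text \<open>Substituting \<open>x \<otimes> inv y\<close> for \<open>x\<close> turns the sum into
  the real inner product of \<open>f\<close> with the convolution of \<open>g\<close> and
  \<open>h\<close>. Cauchy-Schwarz and \<open>convolution_bound\<close> finish, the latter using
  that \<open>h\<close> has mean zero.\<close>

lemma (in group) scalar_trilinear_bound:
  assumes fin: "finite (carrier G)" and D: "0 < d_min G" and mean: "(\<Sum>x\<in>carrier G. h x) = 0"
  shows "(\<Sum>x\<in>carrier G. \<Sum>y\<in>carrier G. f (x \<otimes> y) \<bullet> (g x * h y))
       \<le> sqrt (real (card (carrier G)) / real (d_min G))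
         * (sqrt (norm_sq (carrier G) f) * (sqrt (norm_sq (carrier G) g) * sqrt (norm_sq (carrier G) h)))"
proof -
  let ?C = "carrier G"
  have shift: "(\<Sum>x\<in>?C. f (x \<otimes> y) \<bullet> (g x * h y)) = (\<Sum>x\<in>?C. f x \<bullet> (g (x \<otimes> inv y) * h y))"
    if y: "y \<in> ?C" for y
  proof -
    have "(\<Sum>x\<in>?C. f (x \<otimes> y) \<bullet> (g x * h y)) = (\<Sum>x\<in>?C. f (x \<otimes> y) \<bullet> (g (x \<otimes> y \<otimes> inv y) * h y))"
      using y by (intro sum.cong) (simp_all add: m_assoc)
    also have "\<dots> = (\<Sum>x\<in>?C. f x \<bullet> (g (x \<otimes> inv y) * h y))"
      by (rule sum_right_mult [OF y])
    finally show ?thesis .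
  qed
  have "(\<Sum>x\<in>?C. \<Sum>y\<in>?C. f (x \<otimes> y) \<bullet> (g x * h y)) = (\<Sum>y\<in>?C. \<Sum>x\<in>?C. f x \<bullet> (g (x \<otimes> inv y) * h y))"
    by (subst sum.swap) (simp add: shift)
  also have "\<dots> = (\<Sum>x\<in>?C. f x \<bullet> group_convolution G g h x)"
    by (subst sum.swap) (simp add: group_convolution_def inner_sum_right)
  also have "\<dots> \<le> sqrt (norm_sq ?C f) * sqrt (norm_sq ?C (group_convolution G g h))"
    by (rule sum_inner_complex_le)
  also have "\<dots> \<le> sqrt (norm_sq ?C f)
      * sqrt (real (card ?C) / real (d_min G) * (norm_sq ?C g * norm_sq ?C h))"
  proof (intro mult_left_mono real_sqrt_le_mono)
    show "norm_sq ?C (group_convolution G g h)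
        \<le> real (card ?C) / real (d_min G) * (norm_sq ?C g * norm_sq ?C h)"
      using convolution_bound [OF fin mean, of g] D by (simp add: field_simps)
  qed (simp add: norm_sq_nonneg)
  finally show ?thesis
    by (simp only: real_sqrt_mult mult.left_commute)
qed

lemma norm_sq_matrix: "(norm A)\<^sup>2 = (\<Sum>i\<in>UNIV. \<Sum>j\<in>UNIV. (cmod (A $ i $ j))\<^sup>2)"
  for A :: "complex ^ 'n ^ 'm"
  by (simp add: power2_norm_eq_inner inner_vec_def)

text \<open>Expanding into entries gives scalar trilinear sums for the triples \<open>f i j\<close>,
  \<open>f i k\<close>, \<open>f k j\<close>. Bounding each one separately leaves a cyclic sum in
  the norms \<open>a i j\<close>, so the number of index triples does not enter the bound.\<close>

lemma (in group) matrix_trilinear_bound: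
  fixes F :: "'a \<Rightarrow> complex ^ 'n ^ 'n"
  assumes fin: "finite (carrier G)" and D: "0 < d_min G" and mean: "(\<Sum>x\<in>carrier G. F x) = 0"
  shows "(\<Sum>x\<in>carrier G. \<Sum>y\<in>carrier G. F (x \<otimes> y) \<bullet> (F x ** F y))
       \<le> sqrt (real (card (carrier G)) / real (d_min G)) * sqrt (\<Sum>x\<in>carrier G. (norm (F x))\<^sup>2) ^ 3"
proof -
  let ?C = "carrier G" and ?r = "sqrt (real (card (carrier G)) / real (d_min G))"
  define f where "f i j = (\<lambda>x. F x $ i $ j)" for i j
  define a where "a i j = sqrt (norm_sq ?C (f i j))" for i j
  have mean_f: "(\<Sum>x\<in>?C. f i j x) = 0" for i j
  proof -
    have "(\<Sum>x\<in>?C. F x) $ i $ j = 0"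
      by (simp add: mean)
    then show ?thesis
      by (simp add: f_def)
  qed
  have "(\<Sum>x\<in>?C. \<Sum>y\<in>?C. F (x \<otimes> y) \<bullet> (F x ** F y))
      = (\<Sum>x\<in>?C. \<Sum>y\<in>?C. \<Sum>i\<in>UNIV. \<Sum>j\<in>UNIV. \<Sum>k\<in>UNIV. f i j (x \<otimes> y) \<bullet> (f i k x * f k j y))"
    by (simp add: inner_vec_def matrix_matrix_mult_def inner_sum_right f_def)
  also have "\<dots> = (\<Sum>i\<in>UNIV. \<Sum>x\<in>?C. \<Sum>y\<in>?C. \<Sum>j\<in>UNIV. \<Sum>k\<in>UNIV. f i j (x \<otimes> y) \<bullet> (f i k x * f k j y))"
    by (rule sum_swap_pair)
  also have "\<dots> = (\<Sum>i\<in>UNIV. \<Sum>j\<in>UNIV. \<Sum>x\<in>?C. \<Sum>y\<in>?C. \<Sum>k\<in>UNIV. f i j (x \<otimes> y) \<bullet> (f i k x * f k j y))"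
    by (intro sum.cong refl sum_swap_pair)
  also have "\<dots> = (\<Sum>i\<in>UNIV. \<Sum>j\<in>UNIV. \<Sum>k\<in>UNIV. \<Sum>x\<in>?C. \<Sum>y\<in>?C. f i j (x \<otimes> y) \<bullet> (f i k x * f k j y))"
    by (intro sum.cong refl sum_swap_pair)
  also have "\<dots> \<le> (\<Sum>i\<in>UNIV. \<Sum>j\<in>UNIV. \<Sum>k\<in>UNIV. ?r * (a i j * (a i k * a k j)))"
    unfolding a_def by (intro sum_mono scalar_trilinear_bound fin D mean_f)
  also have "\<dots> = ?r * (\<Sum>i\<in>UNIV. \<Sum>j\<in>UNIV. \<Sum>k\<in>UNIV. a i j * (a i k * a k j))"
    by (simp add: sum_distrib_left)
  also have "\<dots> \<le> ?r * sqrt (\<Sum>i\<in>UNIV. \<Sum>j\<in>UNIV. (a i j)\<^sup>2) ^ 3"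
    by (intro mult_left_mono sum_cyclic_product_le) simp
  also have "(\<Sum>i\<in>UNIV. \<Sum>j\<in>UNIV. (a i j)\<^sup>2) = (\<Sum>i\<in>UNIV. \<Sum>j\<in>UNIV. \<Sum>x\<in>?C. (cmod (f i j x))\<^sup>2)"
    by (simp add: a_def norm_sq_nonneg) (simp add: norm_sq_def)
  also have "\<dots> = (\<Sum>x\<in>?C. \<Sum>i\<in>UNIV. \<Sum>j\<in>UNIV. (cmod (f i j x))\<^sup>2)"
    by (rule sum_swap_pair)
  also have "\<dots> = (\<Sum>x\<in>?C. (norm (F x))\<^sup>2)"
    by (simp add: norm_sq_matrix f_def)
  finally show ?thesis .
qed

section \<open>Separating the mean from the mean zero part\<close>

lemma matrix_add_rdistrib: "(A + B) ** C = A ** C + B ** C" for A :: "'a :: semiring_1 ^ 'n ^ 'm"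
  by (simp add: vec_eq_iff matrix_matrix_mult_def distrib_right sum.distrib)

lemma matrix_mult_sum_right: "A ** (\<Sum>x\<in>S. F x) = (\<Sum>x\<in>S. A ** F x)" for A :: "'a :: semiring_1 ^ 'n ^ 'm"
  by (induction S rule: infinite_finite_induct) (simp_all add: matrix_add_ldistrib)

lemma matrix_mult_sum_left: "(\<Sum>x\<in>S. F x) ** A = (\<Sum>x\<in>S. F x ** A)" for A :: "'a :: semiring_1 ^ 'n ^ 'm"
  by (induction S rule: infinite_finite_induct) (simp_all add: matrix_add_rdistrib)

text \<open>Of the eight terms, each of the six mixed ones has a variable that occurs in exactly one
  factor \<open>F\<close>. Summing over it with the other variable fixed runs \<open>F\<close>
  through the whole group and gives zero.\<close>

lemma (in group) sum_trilinear_mean_decomposition: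
  fixes F :: "'a \<Rightarrow> complex ^ 'n ^ 'n"
  assumes mean: "(\<Sum>x\<in>carrier G. F x) = 0"
  shows "(\<Sum>x\<in>carrier G. \<Sum>y\<in>carrier G. (M + F (x \<otimes> y)) \<bullet> ((M + F x) ** (M + F y)))
       = (real (card (carrier G)))\<^sup>2 * (M \<bullet> (M ** M))
         + (\<Sum>x\<in>carrier G. \<Sum>y\<in>carrier G. F (x \<otimes> y) \<bullet> (F x ** F y))"
proof -
  let ?C = "carrier G"
  have row: "(\<Sum>y\<in>?C. A \<bullet> (B ** F y)) = 0" for A B
    using mean by (simp flip: inner_sum_right matrix_mult_sum_right)
  have col: "(\<Sum>x\<in>?C. A \<bullet> (F x ** B)) = 0" for A B
    using mean by (simp flip: inner_sum_right matrix_mult_sum_left)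
  have left: "(\<Sum>y\<in>?C. F (x \<otimes> y) \<bullet> A) = 0" if "x \<in> ?C" for A x
    using mean sum_left_mult [OF that, of F] by (simp flip: inner_sum_left)
  have right: "(\<Sum>x\<in>?C. F (x \<otimes> y) \<bullet> A) = 0" if "y \<in> ?C" for A y
    using mean sum_right_mult [OF that, of F] by (simp flip: inner_sum_left)
  have "(\<Sum>x\<in>?C. \<Sum>y\<in>?C. (M + F (x \<otimes> y)) \<bullet> ((M + F x) ** (M + F y)))
      = (\<Sum>x\<in>?C. \<Sum>y\<in>?C. M \<bullet> (M ** M)) + (\<Sum>x\<in>?C. \<Sum>y\<in>?C. M \<bullet> (M ** F y))
        + (\<Sum>x\<in>?C. \<Sum>y\<in>?C. M \<bullet> (F x ** M)) + (\<Sum>x\<in>?C. \<Sum>y\<in>?C. M \<bullet> (F x ** F y))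
        + (\<Sum>x\<in>?C. \<Sum>y\<in>?C. F (x \<otimes> y) \<bullet> (M ** M)) + (\<Sum>x\<in>?C. \<Sum>y\<in>?C. F (x \<otimes> y) \<bullet> (F x ** M))
        + (\<Sum>x\<in>?C. \<Sum>y\<in>?C. F (x \<otimes> y) \<bullet> (M ** F y)) + (\<Sum>x\<in>?C. \<Sum>y\<in>?C. F (x \<otimes> y) \<bullet> (F x ** F y))"
    by (simp add: matrix_add_ldistrib matrix_add_rdistrib inner_add_left inner_add_right sum.distrib)
  also have "(\<Sum>x\<in>?C. \<Sum>y\<in>?C. M \<bullet> (F x ** M)) = 0"
    by (subst sum.swap) (simp add: col)
  also have "(\<Sum>x\<in>?C. \<Sum>y\<in>?C. F (x \<otimes> y) \<bullet> (M ** F y)) = 0"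
    by (subst sum.swap) (simp add: right)
  finally show ?thesis
    by (simp add: row left power2_eq_square)
qed

section \<open>The constant term and the operator norm\<close>

lemma norm_matrix_vector_le: "norm (A *v x) \<le> onorm ((*v) A) * norm x" for A :: "complex ^ 'n ^ 'm"
  by (intro onorm matrix_vector_mul_bounded_linear)

text \<open>Column by column: column \<open>j\<close> is the image under \<open>M\<close> of a unit
  vector, so its norm is at most \<open>onorm\<close>; applying \<open>M\<close> once more and
  taking the inner product gives the third power. Summing over the columns supplies the factor
  \<open>CARD('n)\<close>.\<close>

lemma inner_matrix_square_le:
  fixes M :: "complex ^ 'n ^ 'n"
  shows "M \<bullet> (M ** M) \<le> real CARD('n) * onorm ((*v) M) ^ 3"
proof -
  let ?s = "onorm ((*v) M)"
  have s: "?s \<ge> 0"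
    by (intro onorm_pos_le matrix_vector_mul_bounded_linear)
  have "M \<bullet> (M ** M) = (\<Sum>j\<in>UNIV. column j M \<bullet> (M *v column j M))"
    unfolding inner_vec_def
    by (subst sum.swap) (simp add: column_def matrix_vector_mult_def matrix_matrix_mult_def)
  also have "\<dots> \<le> (\<Sum>j\<in>(UNIV :: 'n set). ?s ^ 3)"
  proof (rule sum_mono)
    fix j
    have "column j M = M *v axis j 1"
      by (simp add: vec_eq_iff column_def matrix_vector_mult_def axis_def if_distrib cong: if_cong)
    moreover have "norm (axis j (1 :: complex)) = 1"
      by (simp add: norm_eq_1 inner_axis_axis)
    ultimately have col: "norm (column j M) \<le> ?s"
      using norm_matrix_vector_le [of M "axis j 1"] by simp
    have "column j M \<bullet> (M *v column j M) \<le> norm (column j M) * norm (M *v column j M)"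
      by (rule norm_cauchy_schwarz)
    also have "\<dots> \<le> ?s * (?s * ?s)"
      using col s by (intro mult_mono order_trans [OF norm_matrix_vector_le] mult_left_mono) auto
    finally show "column j M \<bullet> (M *v column j M) \<le> ?s ^ 3"
      by (simp add: power3_eq_cube mult.assoc)
  qed
  finally show ?thesis
    by simp
qed

section \<open>Inner products of unitary matrices\<close>

lemma norm_sq_unitary:
  fixes U :: "complex ^ 'n ^ 'n"
  assumes "U \<in> unitary_matrices"
  shows "(norm U)\<^sup>2 = real CARD('n)"
proof -
  \<comment> \<open>The rows of a unitary matrix are unit vectors, as the diagonal of
    \<open>U ** conjugate_transpose U\<close> shows.\<close>
  have "(\<Sum>j\<in>UNIV. (cmod (U $ i $ j))\<^sup>2) = 1" for i
  proof -
    have "(U ** conjugate_transpose U) $ i $ i = 1"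
      using assms by (simp add: unitary_matrices_def Finite_Cartesian_Product.mat_def)
    then have "(\<Sum>j\<in>UNIV. complex_of_real ((cmod (U $ i $ j))\<^sup>2)) = 1"
      by (simp only: complex_norm_square matrix_matrix_mult_def conjugate_transpose_def vec_lambda_beta)
    then show ?thesis
      by (simp only: of_real_sum [symmetric] of_real_eq_1_iff)
  qed
  then show ?thesis
    by (simp add: norm_sq_matrix)
qed

lemma conjugate_transpose_mult:
  "conjugate_transpose (A ** B) = conjugate_transpose B ** conjugate_transpose A"
  by (simp add: vec_eq_iff conjugate_transpose_def matrix_matrix_mult_def mult.commute)

lemma unitary_matrices_mult:
  assumes "A \<in> unitary_matrices" "B \<in> unitary_matrices"
  shows "A ** B \<in> unitary_matrices"
proof -
  have "A ** B ** (conjugate_transpose B ** conjugate_transpose A)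
      = A ** (B ** conjugate_transpose B) ** conjugate_transpose A"
    "conjugate_transpose B ** conjugate_transpose A ** (A ** B)
      = conjugate_transpose B ** (conjugate_transpose A ** A) ** B"
    by (simp_all add: matrix_mul_assoc)
  then show ?thesis
    using assms by (simp add: unitary_matrices_def conjugate_transpose_mult)
qed

text \<open>The inner product is the real part of the trace pairing. Equal matrices give the squared
  norm, which is the dimension; in general nonnegativity of the squared norm of \<open>U + V\<close>
  gives at least minus the dimension.\<close>

lemma inner_unitary_ge:
  fixes U V :: "complex ^ 'n ^ 'n"
  assumes "U \<in> unitary_matrices" "V \<in> unitary_matrices"
  shows "real CARD('n) * (2 * of_bool (U = V) - 1) \<le> U \<bullet> V"
proof (cases "U = V")
  case True
  then show ?thesis
    using norm_sq_unitary [OF assms(1)] by (simp add: power2_norm_eq_inner)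
next
  case False
  have "0 \<le> (norm (U + V))\<^sup>2"
    by simp
  also have "\<dots> = (norm U)\<^sup>2 + 2 * (U \<bullet> V) + (norm V)\<^sup>2"
    by (simp add: power2_norm_eq_inner inner_add_left inner_add_right inner_commute)
  finally show ?thesis
    using False assms by (simp add: norm_sq_unitary)
qed

section \<open>From counting pairs to the probability bound\<close>

lemma pair_pmf_of_set:
  fixes A :: "'a set" and B :: "'b set"
  assumes "finite A" "A \<noteq> {}" "finite B" "B \<noteq> {}"
  shows "pair_pmf (pmf_of_set A) (pmf_of_set B) = pmf_of_set (A \<times> B)"
proof (rule pmf_eqI)
  fix z :: "'a \<times> 'b"
  obtain a b where "z = (a, b)"
    by fastforce
  then show "pmf (pair_pmf (pmf_of_set A) (pmf_of_set B)) z = pmf (pmf_of_set (A \<times> B)) z"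
    using assms by (simp add: pmf_pair indicator_def card_cartesian_product)
qed

theorem corollary1:
  fixes G :: "('a, 'b) monoid_scheme" (structure)
    and \<psi> :: "'a \<Rightarrow> complex ^ 'n ^ 'n"
  assumes "group G"
    and "finite (carrier G)"
    and "carrier G \<noteq> {\<one>}"
    and "\<psi> \<in> carrier G \<rightarrow> unitary_matrices"
  shows "measure_pmf.prob (pair_pmf (pmf_of_set (carrier G)) (pmf_of_set (carrier G)))
           {(x, y). \<psi> (x \<otimes> y) = \<psi> x ** \<psi> y}
         \<le> 1 / 2 * (1 + onorm ((*v) (measure_pmf.expectation (pmf_of_set (carrier G)) \<psi>)) ^ 3
                   + sqrt (real CARD('n) / real (d_min G)))"
proof -
  interpret group G by fact
  let ?C = "carrier G"
  define n where "n = real (card ?C)"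
  define d where "d = real CARD('n)"
  define D where "D = real (d_min G)"
  define M where "M = measure_pmf.expectation (pmf_of_set ?C) \<psi>"
  define \<sigma> where "\<sigma> = onorm ((*v) M)"
  define F where "F x = \<psi> x - M" for x
  define K where "K = (\<Sum>x\<in>?C. \<Sum>y\<in>?C. of_bool (\<psi> (x \<otimes> y) = \<psi> x ** \<psi> y) :: real)"
  have fin: "finite ?C" and ne: "?C \<noteq> {}"
    using assms(2) by auto
  have n: "n > 0" and d: "d > 0" and D: "D > 0"
    using fin ne d_min_pos [OF assms(2,3)] by (auto simp: n_def d_def D_def card_gt_0_iff)
  have unitary: "\<psi> x \<in> unitary_matrices" if "x \<in> ?C" for x
    using assms(4) that by auto
  have "M = (\<Sum>x\<in>?C. pmf (pmf_of_set ?C) x *\<^sub>R \<psi> x)"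
    unfolding M_def by (rule integral_measure_pmf [OF fin]) (use fin ne in auto)
  also have "\<dots> = (1 / n) *\<^sub>R (\<Sum>x\<in>?C. \<psi> x)"
    using fin ne by (simp add: n_def scaleR_sum_right)
  finally have sum_\<psi>: "(\<Sum>x\<in>?C. \<psi> x) = n *\<^sub>R M"
    using n by simp
  then have mean: "(\<Sum>x\<in>?C. F x) = 0"
    by (simp add: F_def sum_subtractf sum_constant_scaleR n_def del: sum_constant)
  \<comment> \<open>\<open>K\<close> counts the pairs on which \<open>\<psi>\<close> is
    multiplicative. Such a pair contributes \<open>d\<close> to the double sum, every other pair
    \<open>- d\<close>.\<close>
  have "d * (2 * K - n\<^sup>2)
      = (\<Sum>x\<in>?C. \<Sum>y\<in>?C. d * (2 * of_bool (\<psi> (x \<otimes> y) = \<psi> x ** \<psi> y) - 1))"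
    by (simp add: K_def sum_subtractf n_def power2_eq_square right_diff_distrib flip: sum_distrib_left)
  also have "\<dots> \<le> (\<Sum>x\<in>?C. \<Sum>y\<in>?C. \<psi> (x \<otimes> y) \<bullet> (\<psi> x ** \<psi> y))"
    unfolding d_def by (intro sum_mono inner_unitary_ge unitary unitary_matrices_mult) auto
  also have "\<dots> = n\<^sup>2 * (M \<bullet> (M ** M)) + (\<Sum>x\<in>?C. \<Sum>y\<in>?C. F (x \<otimes> y) \<bullet> (F x ** F y))"
    using sum_trilinear_mean_decomposition [OF mean, of M] by (simp add: F_def n_def)
  also have "\<dots> \<le> n\<^sup>2 * (d * \<sigma> ^ 3) + sqrt (n / D) * sqrt (\<Sum>x\<in>?C. (norm (F x))\<^sup>2) ^ 3"
    unfolding n_def d_def D_def \<sigma>_def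
    by (intro add_mono mult_left_mono inner_matrix_square_le matrix_trilinear_bound fin mean
        d_min_pos assms) simp
  \<comment> \<open>Variance identity: removing the mean lowers the total squared norm from
    \<open>n * d\<close> by \<open>n * (norm M)\<^sup>2\<close>, which is then dropped.\<close>
  also have "\<dots> \<le> n\<^sup>2 * (d * \<sigma> ^ 3) + sqrt (n / D) * sqrt (n * d) ^ 3"
  proof -
    have "(\<Sum>x\<in>?C. (norm (F x))\<^sup>2) = (\<Sum>x\<in>?C. (norm (\<psi> x))\<^sup>2 - 2 * (\<psi> x \<bullet> M) + (norm M)\<^sup>2)"
      by (simp add: F_def power2_norm_eq_inner inner_diff_left inner_diff_right inner_commute algebra_simps)
    also have "\<dots> = (\<Sum>x\<in>?C. (norm (\<psi> x))\<^sup>2) - 2 * ((\<Sum>x\<in>?C. \<psi> x) \<bullet> M) + n * (norm M)\<^sup>2"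
      by (simp add: sum.distrib sum_subtractf inner_sum_left n_def sum_distrib_left)
    also have "\<dots> = n * d - n * (norm M)\<^sup>2"
    proof -
      have "(\<Sum>x\<in>?C. (norm (\<psi> x))\<^sup>2) = n * d"
        by (simp add: norm_sq_unitary unitary n_def d_def)
      then show ?thesis
        by (simp add: sum_\<psi> flip: power2_norm_eq_inner)
    qed
    also have "\<dots> \<le> n * d"
      using n by simp
    finally show ?thesis
      using n D by (intro add_left_mono mult_left_mono power_mono real_sqrt_le_mono)
        (simp_all add: sum_nonneg)
  qed
  \<comment> \<open>Extracting the common factor \<open>n\<^sup>2 * d\<close> allows
    \<open>d\<close> to be cancelled and \<open>n\<^sup>2\<close> to become the number of pairs in
    the denominator of the probability.\<close>
  also have "sqrt (n / D) * sqrt (n * d) ^ 3 = n\<^sup>2 * (d * sqrt (d / D))"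
  proof -
    have "sqrt (n * d) ^ 3 = n * d * sqrt (n * d)"
      using n d by (simp add: power3_eq_cube del: real_sqrt_mult)
    then have "sqrt (n / D) * sqrt (n * d) ^ 3 = n * d * (sqrt (n / D) * sqrt (n * d))"
      by simp
    also have "sqrt (n / D) * sqrt (n * d) = n * sqrt (d / D)"
      using n by (simp add: real_sqrt_mult real_sqrt_divide)
    finally show ?thesis
      by (simp add: power2_eq_square)
  qed
  finally have "d * (2 * K - n\<^sup>2) \<le> d * (n\<^sup>2 * (\<sigma> ^ 3 + sqrt (d / D)))"
    by (simp add: algebra_simps)
  then have "2 * K - n\<^sup>2 \<le> n\<^sup>2 * (\<sigma> ^ 3 + sqrt (d / D))"
    using d by (simp only: mult_le_cancel_left_pos)
  then have "2 * K \<le> n\<^sup>2 * (1 + \<sigma> ^ 3 + sqrt (d / D))"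
    by (simp add: algebra_simps)
  then have "K / n\<^sup>2 \<le> 1 / 2 * (1 + \<sigma> ^ 3 + sqrt (d / D))"
    using n by (simp add: field_simps)
  moreover have "measure_pmf.prob (pair_pmf (pmf_of_set ?C) (pmf_of_set ?C))
      {(x, y). \<psi> (x \<otimes> y) = \<psi> x ** \<psi> y} = K / n\<^sup>2"
  proof -
    have "K = (\<Sum>z\<in>?C \<times> ?C. of_bool (z \<in> {(x, y). \<psi> (x \<otimes> y) = \<psi> x ** \<psi> y}))"
      unfolding K_def sum.cartesian_product by (simp add: case_prod_unfold)
    also have "\<dots> = real (card ((?C \<times> ?C) \<inter> {(x, y). \<psi> (x \<otimes> y) = \<psi> x ** \<psi> y}))"
      using fin by (simp add: sum_of_bool_eq)
    finally show ?thesis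
      using fin ne by (simp add: pair_pmf_of_set measure_pmf_of_set card_cartesian_product n_def power2_eq_square)
  qed
  ultimately show ?thesis
    by (simp only: \<sigma>_def M_def d_def D_def)
qed

end
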